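(* Let $\mu\ge 0$ and let $K_n^\mu$ ($n\ge 1$) be the operators $$K_n^\mu(f;x)=\frac{1}{Q(1)\,e_\mu(nx)}\sum_{i=0}^\infty \frac{q_i(nx)}{\gamma_\mu(i)}\, f\!\left(\frac{i+2\mu\theta_i}{n}\right),\qquad x\in[0,\infty),$$ built from a Dunkl-Appell polynomial set $(q_i)$ with generating function $Q(t)e_\mu(xt)$ as described in the context. Let $f:[0,\infty)\to\mathbb{R}$ be uniformly continuous. Then for every $n\ge1$ and every $x\in[0,\infty)$, $$\left|K_n^\mu(f;x)-f(x)\right|\le \bigl(1+\lambda_n(x)\bigr)\,w\!\left(f;\frac{1}{\sqrt n}\right),$$ where $\lambda_n(x)=\sqrt{n\,\Omega_2}$ and $\Omega_2=\Omega_2(n,x)=K_n^\mu\bigl((\xi-x)^2;x\bigr)$.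
   Context: Let $\mu\ge 0$. Put $\theta_i=0$ for even $i$ and $\theta_i=1$ for odd $i$ ($i\in\mathbb{N}_0$). Define $$\gamma_\mu(2i)=\frac{2^{2i}\,i!\,\Gamma(i+\mu+1/2)}{\Gamma(\mu+1/2)},\qquad \gamma_\mu(2i+1)=\frac{2^{2i+1}\,i!\,\Gamma(i+\mu+3/2)}{\Gamma(\mu+1/2)},$$ so that $\gamma_\mu(i+1)=(i+1+2\mu\theta_{i+1})\gamma_\mu(i)$, and $e_\mu(x)=\sum_{i=0}^\infty x^i/\gamma_\mu(i)$. Let $Q(t)=\sum_{i=0}^\infty \frac{a_i}{\gamma_\mu(i)}t^i$ with real coefficients $a_i$, $a_0\ne0$, be analytic in a disc $|t|<R$ with $R>1$, and suppose $Q(1)\neq0$. The associated Dunkl-Appell polynomials $q_i$ are defined by $Q(t)e_\mu(xt)=\sum_{i=0}^\infty \frac{q_i(x)}{\gamma_\mu(i)}t^i$; equivalently $q_i(x)=\sum_{j=0}^i \frac{\gamma_\mu(i)}{\gamma_\mu(j)\gamma_\mu(i-j)}a_{i-j}x^j$. It is assumed that $q_i(x)\ge0$ for all $x\in[0,\infty)$ and all $i$, so that the operators $K_n^\mu$ are positive. In $K_n^\mu((\xi-x)^2;x)$ the operator is applied to the function $\xi\mapsto(\xi-x)^2$ and evaluated at the point $x$. For a uniformly continuous $f$ on $[0,\infty)$ and $\delta\ge0$, the modulus of continuity is $w(f;\delta)=\sup\{|f(\zeta_1)-f(\zeta_2)|:\zeta_1,\zeta_2\in[0,\infty),\ |\zeta_1-\zeta_2|\le\delta\}$.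 *)

theory Defs
  imports "HOL-Analysis.Analysis"
begin

definition dunkl_theta :: "nat \<Rightarrow> real" where
  "dunkl_theta i = (if even i then 0 else 1)"

definition dunkl_gamma :: "real \<Rightarrow> nat \<Rightarrow> real" where
  "dunkl_gamma \<mu> k =
     (if even k
      then 2 ^ k * fact (k div 2) * Gamma (real (k div 2) + \<mu> + 1/2) / Gamma (\<mu> + 1/2)
      else 2 ^ k * fact (k div 2) * Gamma (real (k div 2) + \<mu> + 3/2) / Gamma (\<mu> + 1/2))"

lemma dunkl_gamma_0: "0 \<le> \<mu> \<Longrightarrow> dunkl_gamma \<mu> 0 = 1"
  using less_imp_neq[OF Gamma_real_pos[of "\<mu> + 1/2"]] by (simp add: dunkl_gamma_def)

lemma dunkl_gamma_Suc:
  assumes "0 \<le> \<mu>"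
  shows "dunkl_gamma \<mu> (Suc k) = (real (Suc k) + 2 * \<mu> * dunkl_theta (Suc k)) * dunkl_gamma \<mu> k"
proof (cases "even k")
  case True
  then obtain i where k: "k = 2 * i" by (auto elim: evenE)
  have "Gamma (real i + \<mu> + 1/2 + 1) = (real i + \<mu> + 1/2) * Gamma (real i + \<mu> + 1/2)"
    using assms by (intro Gamma_plus1) auto
  then have "Gamma (real i + \<mu> + 3/2) = (real i + \<mu> + 1/2) * Gamma (real i + \<mu> + 1/2)"
    by (simp add: add.assoc)
  then have "2 * Gamma (real i + \<mu> + 3/2) = (real (Suc k) + 2 * \<mu>) * Gamma (real i + \<mu> + 1/2)"
    by (simp add: k algebra_simps)
  then show ?thesis by (simp add: dunkl_gamma_def dunkl_theta_def k mult.assoc mult.left_commute)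
next
  case False
  then obtain i where k: "k = 2 * i + 1" by (auto elim: oddE)
  show ?thesis by (simp add: dunkl_gamma_def dunkl_theta_def k field_simps)
qed

lemma dunkl_gamma_ge_fact:
  assumes "0 \<le> \<mu>"
  shows "fact k \<le> dunkl_gamma \<mu> k"
proof (induction k)
  case 0
  then show ?case using assms by (simp add: dunkl_gamma_0)
next
  case (Suc k)
  have "fact (Suc k) = real (Suc k) * fact k" by simp
  also have "\<dots> \<le> (real (Suc k) + 2 * \<mu> * dunkl_theta (Suc k)) * dunkl_gamma \<mu> k"
    using Suc assms by (intro mult_mono) (auto simp: dunkl_theta_def)
  finally show ?case using assms by (simp add: dunkl_gamma_Suc)
qed

lemma dunkl_gamma_pos: "0 \<le> \<mu> \<Longrightarrow> 0 < dunkl_gamma \<mu> k"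
  using dunkl_gamma_ge_fact[of \<mu> k] fact_gt_zero[of k, where 'a = real] by linarith

definition dunkl_exp :: "real \<Rightarrow> 'a::{real_normed_field, banach} \<Rightarrow> 'a" where
  "dunkl_exp \<mu> z = (\<Sum>i. z ^ i / of_real (dunkl_gamma \<mu> i))"

(* The function Q with coefficient sequence a; the type of the argument selects the
   real or the complex version. *)
definition dunkl_Q :: "real \<Rightarrow> (nat \<Rightarrow> real) \<Rightarrow> 'a::{real_normed_field, banach} \<Rightarrow> 'a" where
  "dunkl_Q \<mu> a t = (\<Sum>i. of_real (a i / dunkl_gamma \<mu> i) * t ^ i)"

definition dunkl_appell :: "real \<Rightarrow> (nat \<Rightarrow> real) \<Rightarrow> real \<Rightarrow> (nat \<Rightarrow> real \<Rightarrow> real) \<Rightarrow> bool" where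
  "dunkl_appell \<mu> a R q \<longleftrightarrow>
     (\<forall>x::real. \<forall>t::complex. norm t < R \<longrightarrow>
        (\<lambda>i. of_real (q i x / dunkl_gamma \<mu> i) * t ^ i)
          sums (dunkl_Q \<mu> a t * dunkl_exp \<mu> (of_real x * t)))"

(* The generating function determines the q i, and they are the expected polynomials. *)
lemma dunkl_appell_iff:
  assumes mu: "0 \<le> \<mu>" and R: "0 < R"
    and Q: "\<And>t::complex. norm t < R \<Longrightarrow> summable (\<lambda>i. of_real (a i / dunkl_gamma \<mu> i) * t ^ i)"
  shows "dunkl_appell \<mu> a R q \<longleftrightarrow>
    (\<forall>i x. q i x = (\<Sum>j\<le>i. dunkl_gamma \<mu> i / (dunkl_gamma \<mu> j * dunkl_gamma \<mu> (i - j)) * a (i - j) * x ^ j))"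
proof -
  define p where
    "p i x = (\<Sum>j\<le>i. dunkl_gamma \<mu> i / (dunkl_gamma \<mu> j * dunkl_gamma \<mu> (i - j)) * a (i - j) * x ^ j)"
    for i x
  have gpos: "0 < dunkl_gamma \<mu> k" for k using mu by (rule dunkl_gamma_pos)
  have e_summable: "summable (\<lambda>i. norm ((z::complex) ^ i / of_real (dunkl_gamma \<mu> i)))" for z
  proof (rule summable_comparison_test'[OF summable_norm_exp[of z]])
    fix n :: nat
    have "norm (norm (z ^ n / complex_of_real (dunkl_gamma \<mu> n))) = norm z ^ n / dunkl_gamma \<mu> n"
      using gpos[of n] by (simp add: norm_divide norm_power)
    also have "\<dots> \<le> norm z ^ n / fact n"
      by (intro divide_left_mono dunkl_gamma_ge_fact mu mult_pos_pos gpos) auto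
    also have "\<dots> = norm (inverse (fact n) *\<^sub>R z ^ n)"
      by (simp add: norm_power divide_inverse)
    finally show "norm (norm (z ^ n / complex_of_real (dunkl_gamma \<mu> n))) \<le> norm (inverse (fact n) *\<^sub>R z ^ n)" .
  qed
  have p_sums: "(\<lambda>i. of_real (p i x / dunkl_gamma \<mu> i) * t ^ i)
          sums (dunkl_Q \<mu> a t * dunkl_exp \<mu> (of_real x * t))" if t: "norm t < R" for x and t :: complex
  proof -
    obtain r where r: "norm t < r" "r < R" using dense t by blast
    have Qs: "summable (\<lambda>i. norm (of_real (a i / dunkl_gamma \<mu> i) * t ^ i))"
      by (rule powser_insidea[OF Q[of "of_real r"]]) (use r norm_ge_zero[of t] in \<open>simp_all del: norm_ge_zero\<close>)
    have "(\<lambda>k. \<Sum>i\<le>k. ((of_real x * t) ^ i / of_real (dunkl_gamma \<mu> i)) *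
             (of_real (a (k - i) / dunkl_gamma \<mu> (k - i)) * t ^ (k - i)))
          sums (dunkl_exp \<mu> (of_real x * t) * dunkl_Q \<mu> a t)"
      unfolding dunkl_exp_def dunkl_Q_def by (rule Cauchy_product_sums[OF e_summable Qs])
    also have "(\<lambda>k. \<Sum>i\<le>k. ((of_real x * t) ^ i / of_real (dunkl_gamma \<mu> i)) *
             (of_real (a (k - i) / dunkl_gamma \<mu> (k - i)) * t ^ (k - i)))
          = (\<lambda>k. of_real (p k x / dunkl_gamma \<mu> k) * t ^ k)"
    proof
      fix k
      have "((of_real x * t) ^ i / of_real (dunkl_gamma \<mu> i)) *
             (of_real (a (k - i) / dunkl_gamma \<mu> (k - i)) * t ^ (k - i))
           = of_real (dunkl_gamma \<mu> k / (dunkl_gamma \<mu> i * dunkl_gamma \<mu> (k - i)) * a (k - i) * x ^ i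
                / dunkl_gamma \<mu> k) * t ^ k" if "i \<le> k" for i
      proof -
        have "t ^ k = t ^ i * t ^ (k - i)" using that by (simp flip: power_add)
        then show ?thesis using gpos[of k] by (simp add: power_mult_distrib)
      qed
      then show "(\<Sum>i\<le>k. ((of_real x * t) ^ i / of_real (dunkl_gamma \<mu> i)) *
             (of_real (a (k - i) / dunkl_gamma \<mu> (k - i)) * t ^ (k - i)))
          = of_real (p k x / dunkl_gamma \<mu> k) * t ^ k"
        unfolding p_def sum_divide_distrib of_real_sum sum_distrib_right
        by (intro sum.cong) auto
    qed
    finally show ?thesis by (simp add: mult.commute)
  qed
  have "q i x = p i x" if q: "dunkl_appell \<mu> a R q" for i x
  proof (rule ccontr)
    assume ne: "q i x \<noteq> p i x"
    define c where "c k = complex_of_real (q k x / dunkl_gamma \<mu> k) - of_real (p k x / dunkl_gamma \<mu> k)" for k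
    have c: "(\<lambda>k. c k * t ^ k) sums 0" if "norm t < R" for t
      using sums_diff[OF _ p_sums[OF that, of x], of "\<lambda>k. of_real (q k x / dunkl_gamma \<mu> k) * t ^ k"
          "dunkl_Q \<mu> a t * dunkl_exp \<mu> (of_real x * t)"] q that
      by (simp add: dunkl_appell_def c_def left_diff_distrib)
    define f where "f = Abs_fps c"
    have "ereal R \<le> conv_radius c"
      using c by (intro conv_radius_geI_ex') (auto simp: sums_iff)
    then have "0 < fps_conv_radius f"
      using R by (simp add: f_def fps_conv_radius_def order.strict_trans2[of 0 "ereal R"])
    moreover have "eventually (\<lambda>z. eval_fps f z = eval_fps 0 z) (nhds 0)"
      using eventually_nhds_in_open[of "ball 0 R" "0 :: complex"] R
      by (auto elim!: eventually_mono simp: eval_fps_def f_def sums_unique[OF c, symmetric])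
    ultimately have "f = 0" by (intro eval_fps_eqD) auto
    then have "c i = 0" by (simp add: f_def fps_eq_iff)
    then have "q i x / dunkl_gamma \<mu> i = p i x / dunkl_gamma \<mu> i"
      unfolding c_def by (simp only: right_minus_eq of_real_eq_iff)
    then show False using ne gpos[of i] by simp
  qed
  moreover have "dunkl_appell \<mu> a R q" if "\<forall>i x. q i x = p i x"
    using p_sums that by (simp add: dunkl_appell_def)
  ultimately show ?thesis unfolding p_def by blast
qed

(* The functions f and q i are total; only their values on the nonnegative half-line are
   used when x is nonnegative. *)
definition dunkl_op ::
    "real \<Rightarrow> (nat \<Rightarrow> real) \<Rightarrow> (nat \<Rightarrow> real \<Rightarrow> real) \<Rightarrow> nat \<Rightarrow> (real \<Rightarrow> real) \<Rightarrow> real \<Rightarrow> real" where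
  "dunkl_op \<mu> a q n f x =
     1 / (dunkl_Q \<mu> a 1 * dunkl_exp \<mu> (real n * x)) *
     (\<Sum>i. q i (real n * x) / dunkl_gamma \<mu> i * f ((real i + 2 * \<mu> * dunkl_theta i) / real n))"

(* The supremum is finite for every uniformly continuous f on the half-line, so the
   conditionally complete Sup on the reals is the intended one. *)
definition modulus_cont :: "(real \<Rightarrow> real) \<Rightarrow> real \<Rightarrow> real" where
  "modulus_cont f \<delta> =
     Sup {\<bar>f z1 - f z2\<bar> | z1 z2. z1 \<in> {0..} \<and> z2 \<in> {0..} \<and> \<bar>z1 - z2\<bar> \<le> \<delta>}"

end

theory Submission
  imports Defs "HOL-Real_Asymp.Real_Asymp"
begin

text \<open>
  After division by \<open>Q(1) e\<^sub>\<mu>(nx)\<close> the operator is the mean of \<open>f\<close> under a probability distribution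
  on the nodes \<open>\<xi>\<^sub>i = (i + 2\<mu>\<theta>\<^sub>i)/n\<close>, which has a finite second moment because \<open>R > 1\<close>. The estimate
  follows from \<open>|f(\<xi>) - f(x)| \<le> (1 + |\<xi> - x|/\<delta>) w(f;\<delta>)\<close> with \<open>\<delta> = 1/\<surd>n\<close> and from the bound of the mean
  of \<open>|\<xi> - x|\<close> by the root of the mean of \<open>(\<xi> - x)\<^sup>2\<close>.
\<close>

text \<open>Walk from \<open>v\<close> to \<open>u\<close> in \<open>k\<close> steps of length at
  most \<delta> that stay in the half-line, and add up the increments of \<open>f\<close>. The bound
  \<open>B\<close> is left free: it is 1 when the supremum is shown to be finite, and the modulus of
  continuity itself in the scaled estimate.\<close>

lemma chain_bound:
  fixes f :: "real \<Rightarrow> real"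
  assumes step: "\<And>u v. 0 \<le> u \<Longrightarrow> 0 \<le> v \<Longrightarrow> \<bar>u - v\<bar> \<le> \<delta> \<Longrightarrow> \<bar>f u - f v\<bar> \<le> B"
    and "0 \<le> \<delta>" "0 \<le> u" "0 \<le> v" "\<bar>u - v\<bar> \<le> real k * \<delta>"
  shows "\<bar>f u - f v\<bar> \<le> real k * B"
  using assms(3-5)
proof (induction k arbitrary: v)
  case 0
  then show ?case by simp
next
  case (Suc k)
  \<comment> \<open>One step of length \<delta> from \<open>v\<close> towards \<open>u\<close>,
    stopped at \<open>u\<close> if that is nearer. Hence \<open>w\<close> lies between
    \<open>u\<close> and \<open>v\<close> and cannot leave the half-line.\<close>
  define w where "w = (if v \<le> u then min u (v + \<delta>) else max u (v - \<delta>))"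
  have w: "0 \<le> w" "\<bar>u - w\<bar> \<le> real k * \<delta>" "\<bar>w - v\<bar> \<le> \<delta>"
    using Suc.prems \<open>0 \<le> \<delta>\<close> mult_nonneg_nonneg[of "real k" \<delta>]
    by (auto simp: w_def min_def max_def abs_if algebra_simps split: if_splits)
  have "\<bar>f u - f v\<bar> \<le> \<bar>f u - f w\<bar> + \<bar>f w - f v\<bar>" by simp
  also have "\<dots> \<le> real k * B + B"
    using Suc.IH[of w] Suc.prems w step[of w v] by (intro add_mono) auto
  finally show ?case by (simp add: algebra_simps)
qed

text \<open>Without boundedness the real \<open>Sup\<close> in \<open>modulus_cont\<close> could not
  be used as an upper bound. Uniform continuity with tolerance 1 gives a step length, and the number
  of steps needed to cover \<delta> depends on \<delta> alone.\<close>

lemma bdd_above_oscillation: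
  fixes f :: "real \<Rightarrow> real"
  assumes uc: "uniformly_continuous_on {0..} f"
  shows "bdd_above {\<bar>f z1 - f z2\<bar> | z1 z2. z1 \<in> {0..} \<and> z2 \<in> {0..} \<and> \<bar>z1 - z2\<bar> \<le> \<delta>}"
proof -
  obtain d where d: "0 < d" "\<And>u v. 0 \<le> u \<Longrightarrow> 0 \<le> v \<Longrightarrow> \<bar>u - v\<bar> < d \<Longrightarrow> \<bar>f u - f v\<bar> < 1"
    using uc unfolding uniformly_continuous_on_def dist_real_def
    by (metis atLeast_iff zero_less_one)
  \<comment> \<open>Steps of length \<open>d / 2\<close> instead of \<open>d\<close>, since uniform
    continuity asks for distances strictly below \<open>d\<close>.\<close>
  obtain k :: nat where k: "\<delta> < real k * (d / 2)"
    using reals_Archimedean3[of "d / 2"] d(1) by auto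
  have "\<bar>f u - f v\<bar> \<le> real k * 1" if "0 \<le> u" "0 \<le> v" "\<bar>u - v\<bar> \<le> \<delta>" for u v
  proof (rule chain_bound[of "d / 2" f])
    show "\<bar>f u - f v\<bar> \<le> 1" if "0 \<le> u" "0 \<le> v" "\<bar>u - v\<bar> \<le> d / 2" for u v
      using d(2)[OF that(1,2)] that(3) d(1) by linarith
  qed (use that k d(1) in auto)
  then show ?thesis by (intro bdd_aboveI[of _ "real k"]) auto
qed

lemma modulus_cont_upper:
  assumes "uniformly_continuous_on {0..} f" "0 \<le> u" "0 \<le> v" "\<bar>u - v\<bar> \<le> \<delta>"
  shows "\<bar>f u - f v\<bar> \<le> modulus_cont f \<delta>"
  unfolding modulus_cont_def
  by (rule cSup_upper[OF _ bdd_above_oscillation[OF assms(1)]]) (use assms in auto)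

lemma modulus_cont_nonneg:
  assumes "uniformly_continuous_on {0..} f" "0 \<le> \<delta>"
  shows "0 \<le> modulus_cont f \<delta>"
  using modulus_cont_upper[OF assms(1), of 0 0 \<delta>] assms(2) by simp

lemma modulus_cont_scaled:
  assumes uc: "uniformly_continuous_on {0..} f" and "0 \<le> u" "0 \<le> v" and "0 < \<delta>"
  shows "\<bar>f u - f v\<bar> \<le> (1 + \<bar>u - v\<bar> / \<delta>) * modulus_cont f \<delta>"
proof -
  \<comment> \<open>Rounding up costs at most one extra step, which is the source of the summand 1
    in the factor.\<close>
  define k where "k = nat \<lceil>\<bar>u - v\<bar> / \<delta>\<rceil>"
  have "0 \<le> \<bar>u - v\<bar> / \<delta>" using \<open>0 < \<delta>\<close> by simp
  then have k: "\<bar>u - v\<bar> / \<delta> \<le> real k" "real k \<le> 1 + \<bar>u - v\<bar> / \<delta>"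
    unfolding k_def by linarith+
  have "\<bar>f u - f v\<bar> \<le> real k * modulus_cont f \<delta>"
    by (rule chain_bound[of \<delta> f]) (use assms k(1) modulus_cont_upper[OF uc] in \<open>auto simp: field_simps\<close>)
  also have "\<dots> \<le> (1 + \<bar>u - v\<bar> / \<delta>) * modulus_cont f \<delta>"
    using k(2) modulus_cont_nonneg[OF uc, of \<delta>] \<open>0 < \<delta>\<close> by (intro mult_right_mono) auto
  finally show ?thesis .
qed

lemma summable_weighted_abs:
  fixes p u :: "nat \<Rightarrow> real"
  assumes "\<And>i. 0 \<le> p i" "summable p" "summable (\<lambda>i. p i * (u i)\<^sup>2)"
  shows "summable (\<lambda>i. p i * \<bar>u i\<bar>)"
proof (rule summable_comparison_test'[OF summable_add[OF assms(2,3)]])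
  fix i
  \<comment> \<open>Expanding the square gives
    \<open>\<bar>u i\<bar> \<le> 1 / 4 + (u i)\<^sup>2\<close>, slightly more than what
    follows.\<close>
  have "0 \<le> (\<bar>u i\<bar> - 1 / 2)\<^sup>2" by simp
  then have "\<bar>u i\<bar> \<le> 1 + (u i)\<^sup>2"
    by (simp add: power2_diff power_divide)
  then show "norm (p i * \<bar>u i\<bar>) \<le> p i + p i * (u i)\<^sup>2"
    using mult_left_mono[OF _ assms(1)[of i], of "\<bar>u i\<bar>" "1 + (u i)\<^sup>2"] assms(1)[of i]
    by (simp add: abs_mult distrib_left)
qed

text \<open>The variance of \<open>\<bar>u\<bar>\<close> under the weights \<open>p\<close> is the
  mean of the squares minus \<open>m\<^sup>2\<close>, and it is nonnegative.\<close>

lemma mean_abs_le_sqrt_mean_square: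
  fixes p u :: "nat \<Rightarrow> real"
  assumes p: "\<And>i. 0 \<le> p i" "p sums 1" and u: "summable (\<lambda>i. p i * (u i)\<^sup>2)"
  shows "(\<Sum>i. p i * \<bar>u i\<bar>) \<le> sqrt (\<Sum>i. p i * (u i)\<^sup>2)"
proof -
  define m where "m = (\<Sum>i. p i * \<bar>u i\<bar>)"
  have m: "(\<lambda>i. p i * \<bar>u i\<bar>) sums m"
    unfolding m_def using summable_weighted_abs[OF p(1) sums_summable[OF p(2)] u] by (rule summable_sums)
  have "(\<lambda>i. p i * (u i)\<^sup>2 - 2 * m * (p i * \<bar>u i\<bar>) + m\<^sup>2 * p i)
      sums ((\<Sum>i. p i * (u i)\<^sup>2) - 2 * m * m + m\<^sup>2 * 1)"
    by (intro sums_add sums_diff sums_mult m p(2) summable_sums[OF u])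
  moreover have "p i * (u i)\<^sup>2 - 2 * m * (p i * \<bar>u i\<bar>) + m\<^sup>2 * p i = p i * (\<bar>u i\<bar> - m)\<^sup>2" for i
    by (simp add: power2_diff algebra_simps)
  ultimately have "(\<lambda>i. p i * (\<bar>u i\<bar> - m)\<^sup>2) sums ((\<Sum>i. p i * (u i)\<^sup>2) - 2 * m * m + m\<^sup>2 * 1)"
    by simp
  then have "0 \<le> (\<Sum>i. p i * (u i)\<^sup>2) - 2 * m * m + m\<^sup>2 * 1"
    by (rule sums_le[OF _ sums_zero, rotated]) (use p(1) in auto)
  then have "m\<^sup>2 \<le> (\<Sum>i. p i * (u i)\<^sup>2)" by (simp add: power2_eq_square)
  then show ?thesis unfolding m_def by (rule real_le_rsqrt)
qed

text \<open>The theorem for arbitrary probability weights and nodes with finite second moment.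
  Summability is a conclusion of its own because the normalising factor of the operator is later
  moved across the infinite sum.\<close>

lemma mean_modulus_cont:
  fixes p \<xi> :: "nat \<Rightarrow> real"
  assumes p: "\<And>i. 0 \<le> p i" "p sums 1" and \<xi>: "\<And>i. 0 \<le> \<xi> i" "summable (\<lambda>i. p i * (\<xi> i - x)\<^sup>2)"
    and uc: "uniformly_continuous_on {0..} f" and "0 \<le> x" "0 < \<delta>"
  shows "summable (\<lambda>i. p i * f (\<xi> i))"
    and "\<bar>(\<Sum>i. p i * f (\<xi> i)) - f x\<bar>
      \<le> (1 + sqrt (\<Sum>i. p i * (\<xi> i - x)\<^sup>2) / \<delta>) * modulus_cont f \<delta>"
proof -
  define w where "w = modulus_cont f \<delta>"
  have w: "0 \<le> w" using modulus_cont_nonneg[OF uc] \<open>0 < \<delta>\<close> by (simp add: w_def)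
  define m where "m = (\<Sum>i. p i * \<bar>\<xi> i - x\<bar>)"
  have "(\<lambda>i. p i * \<bar>\<xi> i - x\<bar>) sums m"
    unfolding m_def using summable_weighted_abs[OF p(1) sums_summable[OF p(2)] \<xi>(2)] by (rule summable_sums)
  from sums_mult2[OF sums_add[OF p(2) sums_divide[OF this, of \<delta>]], of w]
  have g: "(\<lambda>i. (p i + p i * \<bar>\<xi> i - x\<bar> / \<delta>) * w) sums ((1 + m / \<delta>) * w)" .
  have le: "norm (p i * f (\<xi> i) - p i * f x) \<le> (p i + p i * \<bar>\<xi> i - x\<bar> / \<delta>) * w" for i
  proof -
    have "norm (p i * f (\<xi> i) - p i * f x) = p i * \<bar>f (\<xi> i) - f x\<bar>"
      using p(1)[of i] by (simp add: abs_mult flip: right_diff_distrib)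
    also have "\<dots> \<le> p i * ((1 + \<bar>\<xi> i - x\<bar> / \<delta>) * w)"
      unfolding w_def by (intro mult_left_mono modulus_cont_scaled uc \<xi>(1) p(1) \<open>0 \<le> x\<close> \<open>0 < \<delta>\<close>)
    finally show ?thesis by (simp add: algebra_simps)
  qed
  have d: "summable (\<lambda>i. norm (p i * f (\<xi> i) - p i * f x))"
    by (rule summable_comparison_test'[OF sums_summable[OF g]]) (use le in simp)
  have fx: "(\<lambda>i. p i * f x) sums f x" using sums_mult2[OF p(2), of "f x"] by simp
  \<comment> \<open>Only the differences are dominated so far; adding back the constant
    \<open>f x\<close>, written as a mean, gives convergence of the series for
    \<open>f\<close>.\<close>
  have "(\<lambda>i. (p i * f (\<xi> i) - p i * f x) + p i * f x) sums
      ((\<Sum>i. p i * f (\<xi> i) - p i * f x) + f x)"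
    by (intro sums_add fx summable_sums summable_norm_cancel[OF d])
  then have pf: "(\<lambda>i. p i * f (\<xi> i)) sums ((\<Sum>i. p i * f (\<xi> i) - p i * f x) + f x)"
    by simp
  then show "summable (\<lambda>i. p i * f (\<xi> i))" by (rule sums_summable)
  from pf have "(\<Sum>i. p i * f (\<xi> i)) - f x = (\<Sum>i. p i * f (\<xi> i) - p i * f x)"
    by (simp add: sums_iff)
  also have "\<bar>\<dots>\<bar> \<le> (\<Sum>i. norm (p i * f (\<xi> i) - p i * f x))"
    using summable_norm[OF d] by simp
  also have "\<dots> \<le> (1 + m / \<delta>) * w"
    using suminf_le[OF le d sums_summable[OF g]] g by (simp add: sums_iff)
  also have "\<dots> \<le> (1 + sqrt (\<Sum>i. p i * (\<xi> i - x)\<^sup>2) / \<delta>) * w"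
    using mean_abs_le_sqrt_mean_square[OF p \<xi>(2)] w \<open>0 < \<delta>\<close>
    by (intro mult_right_mono add_left_mono divide_right_mono) (auto simp: m_def)
  finally show "\<bar>(\<Sum>i. p i * f (\<xi> i)) - f x\<bar>
      \<le> (1 + sqrt (\<Sum>i. p i * (\<xi> i - x)\<^sup>2) / \<delta>) * modulus_cont f \<delta>"
    by (simp add: w_def)
qed

lemma summable_dunkl_exp:
  fixes y :: real
  assumes "0 \<le> \<mu>"
  shows "summable (\<lambda>i. y ^ i / dunkl_gamma \<mu> i)"
proof (rule summable_comparison_test'[OF summable_norm_exp[of y]])
  fix i
  have "norm (y ^ i / dunkl_gamma \<mu> i) = \<bar>y\<bar> ^ i / dunkl_gamma \<mu> i"
    using dunkl_gamma_pos[OF assms, of i] by (simp add: power_abs)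
  also have "\<dots> \<le> \<bar>y\<bar> ^ i / fact i"
    using dunkl_gamma_pos[OF assms, of i]
    by (intro divide_left_mono dunkl_gamma_ge_fact assms) auto
  finally show "norm (y ^ i / dunkl_gamma \<mu> i) \<le> norm (y ^ i /\<^sub>R fact i)"
    by (simp add: power_abs divide_inverse mult.commute abs_mult)
qed

lemma dunkl_exp_of_real:
  assumes "0 \<le> \<mu>"
  shows "dunkl_exp \<mu> (complex_of_real y) = of_real (dunkl_exp \<mu> y)"
  unfolding dunkl_exp_def using suminf_of_real[OF summable_dunkl_exp[OF assms, of y], where 'a = complex]
  by simp

lemma dunkl_Q_of_real:
  assumes "summable (\<lambda>i. complex_of_real (a i / dunkl_gamma \<mu> i) * of_real t ^ i)"
  shows "dunkl_Q \<mu> a (complex_of_real t) = of_real (dunkl_Q \<mu> a t)"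
proof -
  have "summable (\<lambda>i. complex_of_real (a i / dunkl_gamma \<mu> i * t ^ i))"
    using assms by simp
  then have "summable (\<lambda>i. a i / dunkl_gamma \<mu> i * t ^ i)"
    by (rule summable_complex_of_real[THEN iffD1])
  from suminf_of_real[OF this, where 'a = complex] show ?thesis
    unfolding dunkl_Q_def by simp
qed

lemma dunkl_exp_ge_1:
  fixes y :: real
  assumes "0 \<le> \<mu>" "0 \<le> y"
  shows "1 \<le> dunkl_exp \<mu> y"
  using sum_le_suminf[OF summable_dunkl_exp[OF assms(1), of y], of "{0}"]
    dunkl_gamma_pos[OF assms(1)] assms
  by (simp add: dunkl_exp_def dunkl_gamma_0 less_imp_le)

text \<open>The generating identity is given for complex \<open>t\<close>, while the operator is
  real; both sides are real at real arguments.\<close>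

lemma dunkl_appell_sums:
  fixes t y :: real
  assumes mu: "0 \<le> \<mu>" and app: "dunkl_appell \<mu> a R q" and t: "\<bar>t\<bar> < R"
    and Q: "\<And>t::complex. norm t < R \<Longrightarrow> summable (\<lambda>i. of_real (a i / dunkl_gamma \<mu> i) * t ^ i)"
  shows "(\<lambda>i. q i y / dunkl_gamma \<mu> i * t ^ i) sums (dunkl_Q \<mu> a t * dunkl_exp \<mu> (y * t))"
proof -
  have t': "norm (complex_of_real t) < R" using t by simp
  have "(\<lambda>i. of_real (q i y / dunkl_gamma \<mu> i) * complex_of_real t ^ i)
      sums (dunkl_Q \<mu> a (complex_of_real t) * dunkl_exp \<mu> (of_real y * complex_of_real t))"
    using app t' unfolding dunkl_appell_def by blast
  then have "(\<lambda>i. complex_of_real (q i y / dunkl_gamma \<mu> i * t ^ i))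
      sums complex_of_real (dunkl_Q \<mu> a t * dunkl_exp \<mu> (y * t))"
    using dunkl_Q_of_real[OF Q[OF t']] dunkl_exp_of_real[OF mu, of "y * t"] by simp
  then show ?thesis by (simp only: sums_of_real_iff)
qed

text \<open>Convergence at some \<open>r > 1\<close> leaves room for a polynomial factor: eventually
  \<open>(real i + 1)\<^sup>2 \<le> r ^ i\<close>.\<close>

lemma summable_quadratic_growth:
  fixes c g :: "nat \<Rightarrow> real"
  assumes c: "\<And>i. 0 \<le> c i" "summable (\<lambda>i. c i * r ^ i)" and r: "1 < r"
    and g: "\<And>i. \<bar>g i\<bar> \<le> K * (real i + 1)"
  shows "summable (\<lambda>i. c i * (g i)\<^sup>2)"
proof (rule summable_comparison_test_ev[OF _ summable_mult[OF c(2), of "K\<^sup>2"]])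
  have "(\<lambda>i. (real i + 1)\<^sup>2 / r ^ i) \<longlonglongrightarrow> 0" using r by real_asymp
  then have "eventually (\<lambda>i. (real i + 1)\<^sup>2 / r ^ i < 1) sequentially"
    by (rule order_tendstoD) simp
  then show "eventually (\<lambda>i. norm (c i * (g i)\<^sup>2) \<le> K\<^sup>2 * (c i * r ^ i)) sequentially"
  proof eventually_elim
    case (elim i)
    then have i: "(real i + 1)\<^sup>2 \<le> r ^ i" using r by (simp add: field_simps)
    have "(g i)\<^sup>2 \<le> (K * (real i + 1))\<^sup>2" using power_mono[OF g[of i], of 2] by simp
    also have "\<dots> \<le> K\<^sup>2 * r ^ i" using i by (simp add: power_mult_distrib mult_left_mono)
    finally show ?case using mult_left_mono[OF _ c(1)[of i]] c(1)[of i]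
      by (simp add: abs_mult mult.left_commute)
  qed
qed

theorem theorem2:
  fixes \<mu> R x :: real and a :: "nat \<Rightarrow> real" and q :: "nat \<Rightarrow> real \<Rightarrow> real"
    and f :: "real \<Rightarrow> real" and n :: nat
  assumes "0 \<le> \<mu>" and "a 0 \<noteq> 0" and "1 < R"
    and "\<And>t::complex. norm t < R \<Longrightarrow> summable (\<lambda>i. of_real (a i / dunkl_gamma \<mu> i) * t ^ i)"
    and "(dunkl_Q \<mu> a :: complex \<Rightarrow> complex) analytic_on ball 0 R"
    and "dunkl_Q \<mu> a (1::real) \<noteq> 0"
    and "dunkl_appell \<mu> a R q"
    and "\<And>i y. 0 \<le> y \<Longrightarrow> 0 \<le> q i y"
    and "uniformly_continuous_on {0..} f"
    and "1 \<le> n" and "0 \<le> x"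
  shows "\<bar>dunkl_op \<mu> a q n f x - f x\<bar>
    \<le> (1 + sqrt (real n * dunkl_op \<mu> a q n (\<lambda>\<xi>. (\<xi> - x)\<^sup>2) x)) * modulus_cont f (1 / sqrt (real n))"
proof -
  define y where "y = real n * x"
  have y: "0 \<le> y" using assms(11) by (simp add: y_def)
  define c where "c i = q i y / dunkl_gamma \<mu> i" for i
  define S where "S = dunkl_Q \<mu> a (1::real) * dunkl_exp \<mu> y"
  define \<xi> where "\<xi> i = (real i + 2 * \<mu> * dunkl_theta i) / real n" for i
  have c0: "0 \<le> c i" for i
    using assms(8)[OF y] dunkl_gamma_pos[OF assms(1), of i] by (simp add: c_def)
  \<comment> \<open>Used at \<open>t = 1\<close> for the total mass \<open>S\<close>, and at some
    \<open>t > 1\<close> for the second moment.\<close>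
  have sums: "(\<lambda>i. c i * t ^ i) sums (dunkl_Q \<mu> a t * dunkl_exp \<mu> (y * t))" if "\<bar>t\<bar> < R" for t
    unfolding c_def using dunkl_appell_sums[OF assms(1,7) that assms(4)] .
  have cS: "c sums S" using sums[of 1] assms(3) by (simp add: S_def)
  \<comment> \<open>\<open>Q(1)\<close> is only assumed nonzero; the sign of \<open>S\<close> comes
    from the nonnegative terms of its series.\<close>
  have "0 \<le> S" using sums_le[OF _ sums_zero cS] c0 by simp
  moreover have "S \<noteq> 0" using assms(6) dunkl_exp_ge_1[OF assms(1) y] by (simp add: S_def)
  ultimately have S: "0 < S" by simp
  obtain r where r: "1 < r" "r < R" using dense assms(3) by blast
  have "summable (\<lambda>i. c i * (\<xi> i - x)\<^sup>2)"
  proof (rule summable_quadratic_growth[OF c0 sums_summable[OF sums[of r]] r(1)])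
    fix i
    have \<theta>: "0 \<le> 2 * \<mu> * dunkl_theta i" "2 * \<mu> * dunkl_theta i \<le> 2 * \<mu>"
      using assms(1) by (auto simp: dunkl_theta_def)
    have "0 \<le> \<xi> i" using \<theta> by (simp add: \<xi>_def)
    moreover have "\<xi> i \<le> real i + 2 * \<mu>"
      unfolding \<xi>_def using \<theta> assms(10) frac_le[of "real i + 2 * \<mu>" "real i + 2 * \<mu> * dunkl_theta i" 1 "real n"]
      by simp
    \<comment> \<open>These are the mixed products in the expansion of
      \<open>(1 + 2 * \<mu> + x) * (real i + 1)\<close>; once they are known to be nonnegative, the
      bound is linear.\<close>
    moreover have "0 \<le> 2 * \<mu> * real i" "0 \<le> x * real i" using assms(1,11) by simp_all
    ultimately show "\<bar>\<xi> i - x\<bar> \<le> (1 + 2 * \<mu> + x) * (real i + 1)"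
      using assms(1,11) unfolding distrib_left distrib_right by linarith
  qed (use r in auto)
  from summable_divide[OF this, of S] have sq: "summable (\<lambda>i. c i / S * (\<xi> i - x)\<^sup>2)" by simp
  have \<xi>: "0 \<le> \<xi> i" for i using assms(1) by (simp add: \<xi>_def dunkl_theta_def)
  have p: "0 \<le> c i / S" "(\<lambda>i. c i / S) sums 1" for i
    using c0 S sums_divide[OF cS, of S] by auto
  have op: "dunkl_op \<mu> a q n g x = (\<Sum>i. c i / S * g (\<xi> i))" if "summable (\<lambda>i. c i / S * g (\<xi> i))" for g
  proof -
    have "(\<Sum>i. c i * g (\<xi> i)) = S * (\<Sum>i. c i / S * g (\<xi> i))"
      using suminf_mult[OF that, of S] S by simp
    then show ?thesis
      using S by (simp add: dunkl_op_def flip: c_def \<xi>_def y_def S_def)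
  qed
  have \<delta>: "0 < 1 / sqrt (real n)" using assms(10) by simp
  note mean = mean_modulus_cont[OF p \<xi> sq assms(9,11) \<delta>]
  show ?thesis
    \<comment> \<open>Dividing by \<delta> multiplies by \<open>sqrt (real n)\<close>, which merges
      with the root of the second moment.\<close>
    using mean(2) by (simp add: op[OF mean(1)] op[OF sq] real_sqrt_mult mult.commute)
qed

end
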